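(* Let $k\le n$ be positive integers. Then $\textsc{bm}(k,n,n)\ge\min(k,\lceil n/2\rceil)$; that is, every $(k,n,n)$-fractionally balanced tripartite hypergraph has a matching of size $\min(k,\lceil n/2\rceil)$.
   Context: A hypergraph is identified with its finite edge set; a matching is a set of pairwise disjoint edges. A hypergraph $H$ is $k$-partite with sides $V_1,\ldots,V_k$ (a fixed partition of its vertex set) if $|e\cap V_t|=1$ for every edge $e$ and every $t$. For $f:H\to\mathbb{R}_{\ge0}$, $\deg_f(v)=\sum_{e\ni v}f(e)$; $f$ is balanced if $\deg_f$ is constant on each side. $H$ is $(b_1,\ldots,b_k)$-fractionally balanced if it is $k$-partite with sides of sizes $b_1,\ldots,b_k$ and has a nonzero balanced $f:H\to\mathbb{R}_{\ge0}$. $\textsc{bm}(b_1,\ldots,b_k)$ is the largest $m$ such that every $(b_1,\ldots,b_k)$-fractionally balanced $k$-partite hypergraph has a matching of size $m$. *)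

theory Defs
  imports Complex_Main "HOL-Library.Disjoint_Sets"
begin

text \<open>A hypergraph is its finite set of edges. The fixed partition of the vertex set
  into sides is the list \<open>Vs\<close>; the vertex set itself is \<open>\<Union>(set Vs)\<close>.\<close>

definition matching :: "'a set set \<Rightarrow> 'a set set \<Rightarrow> bool" where
  "matching H M \<longleftrightarrow> M \<subseteq> H \<and> disjoint M"

definition partite :: "'a set list \<Rightarrow> 'a set set \<Rightarrow> bool" where
  "partite Vs H \<longleftrightarrow>
     finite H \<and>
     (\<forall>s<length Vs. \<forall>t<length Vs. s \<noteq> t \<longrightarrow> Vs ! s \<inter> Vs ! t = {}) \<and>
     (\<forall>e\<in>H. e \<subseteq> \<Union>(set Vs) \<and> (\<forall>t<length Vs. card (e \<inter> Vs ! t) = 1))"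

definition deg :: "'a set set \<Rightarrow> ('a set \<Rightarrow> real) \<Rightarrow> 'a \<Rightarrow> real" where
  "deg H f v = (\<Sum>e | e \<in> H \<and> v \<in> e. f e)"

definition balanced :: "'a set list \<Rightarrow> 'a set set \<Rightarrow> ('a set \<Rightarrow> real) \<Rightarrow> bool" where
  "balanced Vs H f \<longleftrightarrow>
     (\<forall>t<length Vs. \<forall>u\<in>Vs ! t. \<forall>v\<in>Vs ! t. deg H f u = deg H f v)"

definition fractionally_balanced :: "nat list \<Rightarrow> 'a set list \<Rightarrow> 'a set set \<Rightarrow> bool" where
  "fractionally_balanced bs Vs H \<longleftrightarrow>
     partite Vs H \<and>
     length Vs = length bs \<and>
     (\<forall>t<length bs. finite (Vs ! t) \<and> card (Vs ! t) = bs ! t) \<and>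
     (\<exists>f. (\<forall>e\<in>H. f e \<ge> 0) \<and> (\<exists>e\<in>H. f e \<noteq> 0) \<and> balanced Vs H f)"

text \<open>Vertices are taken to be natural numbers: the vertex sets are finite, so up to
  isomorphism every hypergraph in question occurs. The greatest element exists whenever
  \<open>bs\<close> is a nonempty list of positive numbers: the value \<open>0\<close> always qualifies, and the
  complete multipartite hypergraph bounds the values by the least entry of \<open>bs\<close>.\<close>

definition bm :: "nat list \<Rightarrow> nat" where
  "bm bs = (GREATEST m. \<forall>(Vs :: nat set list) H.
     fractionally_balanced bs Vs H \<longrightarrow> (\<exists>M. matching H M \<and> card M = m))"

end

theory Submission
  imports Defs "HOL-Library.Z2"
begin

text \<open>Colour each edge by its vertex in the side of size \<open>k\<close> and let two edges conflict if they
  meet in one of the sides of size \<open>n\<close>; a matching is a rainbow independent set. Such a set exists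
  as soon as, for every set \<open>I\<close> of colours, the independence complex of the edges coloured by \<open>I\<close>
  has no mod 2 homology below dimension \<open>card I - 1\<close>: one then builds a chain map from the simplex
  of all colours and applies Sperner's parity argument. The complex of matchings of a graph with
  matching number \<open>\<nu>\<close> has no homology below dimension \<open>\<nu>/2 - 1\<close>, because deleting an edge outside
  a maximum matching preserves \<open>\<nu>\<close> and passing to its link lowers \<open>\<nu>\<close> by at most 2. In a
  fractionally balanced hypergraph the edges coloured by \<open>I\<close> carry a fractional matching of weight
  \<open>card I * n / k\<close>, hence, the link graph being bipartite, an integral matching of that size. Its
  existence (a form of Hall's theorem) follows from the same rainbow theorem. For \<open>k > n/2\<close> only
  a partial rainbow set is wanted, so the rainbow theorem is used in its deficiency form.\<close>

section \<open>Mod 2 chains in independence complexes\<close>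

lemma bit_add_self: "a + a = 0" for a :: bit
  by (cases a) simp_all

lemma bit_add_left_cancel: "a + (a + b) = b" for a b :: bit
  by (cases a) simp_all

lemma bit_add_eq_0_iff: "a + b = 0 \<longleftrightarrow> a = b" for a b :: bit
  by (cases a; cases b) simp_all

text \<open>These rules would turn every sum over \<open>bit\<close> into a propositional case split.\<close>

declare add_bit_eq_xor [simp del] mult_bit_eq_and [simp del] bit_not_zero_iff [simp del]

lemmas bit_add_simps = bit_add_self bit_add_left_cancel bit_add_eq_0_iff

text \<open>Every unordered pair is counted twice. This is the cancellation that makes the boundary
  of a boundary vanish.\<close>

lemma bit_sum_symmetric_off_diagonal:
  fixes g :: "'a \<Rightarrow> 'a \<Rightarrow> bit"
  assumes "finite D" and sym: "\<And>x y. x \<in> D \<Longrightarrow> y \<in> D \<Longrightarrow> g x y = g y x"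
  shows "(\<Sum>x\<in>D. \<Sum>y\<in>D - {x}. g x y) = 0"
  using assms
proof (induction D rule: finite_induct)
  case (insert z D)
  have "(\<Sum>y\<in>insert z D - {x}. g x y) = g x z + (\<Sum>y\<in>D - {x}. g x y)" if "x \<in> D" for x
  proof -
    have "insert z D - {x} = insert z (D - {x})"
      using insert.hyps(2) that by auto
    then show ?thesis
      using insert.hyps by simp
  qed
  then have "(\<Sum>x\<in>D. \<Sum>y\<in>insert z D - {x}. g x y) = (\<Sum>x\<in>D. g x z) + (\<Sum>x\<in>D. \<Sum>y\<in>D - {x}. g x y)"
    by (simp add: sum.distrib)
  also have "\<dots> = (\<Sum>x\<in>D. g z x)"
    using insert.IH insert.prems by (auto intro!: sum.cong)
  finally have "(\<Sum>x\<in>insert z D. \<Sum>y\<in>insert z D - {x}. g x y)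
      = (\<Sum>y\<in>D. g z y) + (\<Sum>x\<in>D. g z x)"
    using insert.hyps by (simp add: insert_Diff_if)
  then show ?case
    by (simp add: bit_add_self)
qed simp

section \<open>Simplicial chains, boundaries and cones\<close>

definition boundary :: "'v set \<Rightarrow> ('v set \<Rightarrow> bit) \<Rightarrow> 'v set \<Rightarrow> bit" where
  "boundary W c s = (\<Sum>x\<in>W - s. c (insert x s))"

text \<open>The join with the apex \<open>v\<close>. Values of \<open>c\<close> on sets containing
  \<open>v\<close> are never read, so the cone drops simplices through \<open>v\<close>.\<close>

definition cone :: "'v \<Rightarrow> ('v set \<Rightarrow> bit) \<Rightarrow> 'v set \<Rightarrow> bit" where
  "cone v c s = (if v \<in> s then c (s - {v}) else 0)"

definition indep :: "('v \<Rightarrow> 'v \<Rightarrow> bool) \<Rightarrow> 'v set \<Rightarrow> bool" where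
  "indep R s \<longleftrightarrow> (\<forall>x\<in>s. \<forall>y\<in>s. x \<noteq> y \<longrightarrow> \<not> R x y)"

text \<open>\<open>j\<close> counts vertices, so the dimension is \<open>j - 1\<close>; the empty
  set is a simplex of size 0, which makes the homology reduced. \<open>boundary\<close> refers to
  the ambient \<open>W\<close> and not to \<open>V\<close>, so chains on different subcomplexes
  share one operator.\<close>

definition chain :: "('v \<Rightarrow> 'v \<Rightarrow> bool) \<Rightarrow> 'v set \<Rightarrow> nat \<Rightarrow> ('v set \<Rightarrow> bit) \<Rightarrow> bool" where
  "chain R V j c \<longleftrightarrow> (\<forall>s. c s \<noteq> 0 \<longrightarrow> s \<subseteq> V \<and> indep R s \<and> card s = j)"

lemma boundary_add: "boundary W (\<lambda>s. c s + d s) s = boundary W c s + boundary W d s"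
  by (simp add: boundary_def sum.distrib)

lemma boundary_cone_notin:
  assumes "finite W" "v \<in> W" "v \<notin> s"
  shows "boundary W (cone v c) s = c s"
proof -
  have "boundary W (cone v c) s = (\<Sum>x\<in>W - s. if x = v then c s else 0)"
    unfolding boundary_def using assms(3) by (intro sum.cong) (auto simp: cone_def)
  then show ?thesis
    using assms by simp
qed

text \<open>With \<open>boundary_cone_notin\<close> this says that the boundary of the cone is
  \<open>c\<close> plus the cone over the boundary of \<open>c\<close>. The sum
  \<open>boundary W c (s - {v})\<close> has a term \<open>c s\<close> at \<open>x = v\<close>, which
  the cone drops; the extra \<open>c s\<close> cancels it.\<close>

lemma boundary_cone_in:
  assumes "finite W" "v \<in> W" "v \<in> s"
  shows "boundary W (cone v c) s = boundary W c (s - {v}) + c s"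
proof -
  have "boundary W (cone v c) s = (\<Sum>x\<in>W - s. c (insert x (s - {v})))"
    unfolding boundary_def cone_def using assms(3)
    by (intro sum.cong) (auto simp: insert_Diff_if)
  moreover have "W - (s - {v}) = insert v (W - s)"
    using assms by auto
  then have "boundary W c (s - {v}) = c s + (\<Sum>x\<in>W - s. c (insert x (s - {v})))"
    unfolding boundary_def using assms by (simp add: insert_absorb)
  ultimately show ?thesis
    by (simp add: bit_add_simps add.commute add.left_commute)
qed

lemma indep_insert:
  assumes "symp R" "indep R s" "\<And>u. u \<in> s \<Longrightarrow> u \<noteq> v \<Longrightarrow> \<not> R v u"
  shows "indep R (insert v s)"
  using assms unfolding indep_def by (auto dest: sympD)

lemma indep_subset: "indep R s \<Longrightarrow> t \<subseteq> s \<Longrightarrow> indep R t"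
  by (auto simp: indep_def)

lemma chain_mono: "chain R V j c \<Longrightarrow> V \<subseteq> V' \<Longrightarrow> chain R V' j c"
  by (meson chain_def order_trans)

lemma chain_add: "chain R V j c \<Longrightarrow> chain R V j d \<Longrightarrow> chain R V j (\<lambda>s. c s + d s)"
  unfolding chain_def by (metis add_0)

text \<open>The condition \<open>u \<noteq> v\<close> admits \<open>v \<in> L\<close>, as needed for
  coning a simplex from one of its own vertices.\<close>

lemma chain_cone:
  assumes "symp R" "finite V" "chain R L j c" "L \<subseteq> V" "v \<in> V"
    and "\<And>u. u \<in> L \<Longrightarrow> u \<noteq> v \<Longrightarrow> \<not> R v u"
  shows "chain R V (Suc j) (cone v c)"
  unfolding chain_def
proof (intro allI impI)
  fix s assume "cone v c s \<noteq> 0"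
  then have s: "v \<in> s" "c (s - {v}) \<noteq> 0"
    by (auto simp: cone_def split: if_splits)
  then have t: "s - {v} \<subseteq> L" "indep R (s - {v})" "card (s - {v}) = j"
    using assms(3) by (auto simp: chain_def)
  have "indep R (insert v (s - {v}))"
    using t assms by (intro indep_insert) auto
  moreover have "s \<subseteq> V"
    using t assms(4,5) by auto
  moreover have "finite s"
    using \<open>s \<subseteq> V\<close> assms(2) finite_subset by blast
  ultimately show "s \<subseteq> V \<and> indep R s \<and> card s = Suc j"
    using s(1) t(3) by (simp add: insert_absorb card_Diff_singleton)
      (metis card_Suc_Diff1 t(3))
qed

text \<open>In homological terms: the independence complex on \<open>V\<close> has vanishing reduced homology
  in dimension \<open>j - 1\<close> as soon as the weight of \<open>N\<close> exceeds \<open>r * j\<close>. If \<open>V = N\<close> the complex is a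
  simplex. Otherwise a vertex outside \<open>N\<close> is split off: deleting it leaves \<open>N\<close> intact, and
  passing to its link costs weight at most \<open>r\<close> and lowers the dimension by one.\<close>

lemma independence_complex_filling:
  fixes w :: "'v \<Rightarrow> nat"
  assumes W: "finite W" and R: "symp R"
    and "V \<subseteq> W" "N \<subseteq> V" "indep R N"
    and "\<And>v. v \<in> V \<Longrightarrow> (\<Sum>u | u \<in> N \<and> (u = v \<or> R v u). w u) \<le> r"
    and "r * j < sum w N"
    and "chain R V j c" "\<And>s. boundary W c s = 0"
  shows "\<exists>u. chain R V (Suc j) u \<and> (\<forall>s. boundary W u s = c s)"
  using assms(3-)
proof (induction "card V" arbitrary: V N j c rule: less_induct)
  case less
  have finV: "finite V"
    using W less.prems(1) finite_subset by blast
  then have finN: "finite N"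
    using less.prems(2) finite_subset by blast
  show ?case
  proof (cases "V = N")
    case True
    \<comment> \<open>The weight inequality is strict, so the simplex has a vertex to cone from, and
      the cone over a cycle has that cycle as boundary.\<close>
    have "N \<noteq> {}"
      using less.prems(5) by auto
    then obtain v where v: "v \<in> N"
      by blast
    have "chain R V (Suc j) (cone v c)"
      using v True less.prems(3) by (intro chain_cone[OF R finV less.prems(6)]) (auto simp: indep_def)
    moreover have "boundary W (cone v c) s = c s" for s
      using boundary_cone_in[OF W] boundary_cone_notin[OF W] less.prems(1,2,7) v
      by (cases "v \<in> s") (auto simp: subset_iff)
    ultimately show ?thesis
      by blast
  next
    case False
    then obtain v where v: "v \<in> V" "v \<notin> N"
      using less.prems(2) by blast
    then have vW: "v \<in> W"
      using less.prems(1) by blast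
    define D where "D = V - {v}"
    have DV: "D \<subseteq> V" "card D < card V" "N \<subseteq> D"
      using v finV less.prems(2) card_Diff1_less[OF finV v(1)] unfolding D_def by auto
    have fill_D: "\<exists>u. chain R D (Suc j) u \<and> (\<forall>s. boundary W u s = z s)"
      if "chain R D j z" "\<And>s. boundary W z s = 0" for z
      using less.hyps[OF DV(2) _ DV(3) less.prems(3) _ less.prems(5) that] less.prems(1,4) DV(1)
      by blast
    show ?thesis
    proof (cases j)
      case 0
      \<comment> \<open>For \<open>j = 0\<close> the only simplex is the empty set, which avoids
        \<open>v\<close>, so the link does not enter.\<close>
      have "chain R D j c"
        unfolding chain_def
      proof (intro allI impI)
        fix s assume "c s \<noteq> 0"
        then have "s \<subseteq> V" "indep R s" "card s = j"
          using less.prems(6) by (auto simp: chain_def)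
        moreover from this have "s = {}"
          using 0 finV finite_subset by fastforce
        ultimately show "s \<subseteq> D \<and> indep R s \<and> card s = j"
          by simp
      qed
      then show ?thesis
        using fill_D less.prems(7) chain_mono[OF _ DV(1)] by blast
    next
      case (Suc i)
      \<comment> \<open>\<open>L\<close> spans the link of \<open>v\<close>, and \<open>b\<close> is
        the link part of \<open>c\<close>: the chain \<open>c\<close> is its part avoiding
        \<open>v\<close> plus the cone over \<open>b\<close>.\<close>
      define L where "L = {u \<in> V. u \<noteq> v \<and> \<not> R v u}"
      define b where "b = (\<lambda>s. if v \<in> s then 0 else c (insert v s))"
      have LD: "L \<subseteq> D" "L \<subseteq> V"
        unfolding L_def D_def by auto
      have "card L < card V"
        using LD DV finV by (meson card_mono finite_subset le_less_trans)
      moreover have "indep R (N \<inter> L)"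
        using less.prems(3) indep_subset by blast
      moreover have "(\<Sum>u | u \<in> N \<inter> L \<and> (u = x \<or> R x u). w u) \<le> r" if "x \<in> L" for x
      proof -
        have "(\<Sum>u | u \<in> N \<inter> L \<and> (u = x \<or> R x u). w u) \<le> (\<Sum>u | u \<in> N \<and> (u = x \<or> R x u). w u)"
          using finN by (intro sum_mono2) auto
        then show ?thesis
          using less.prems(4)[of x] that LD by auto
      qed
      \<comment> \<open>Since \<open>v \<notin> N\<close>, the members of \<open>N\<close> lost are
        neighbours of \<open>v\<close>. They weigh at most \<open>r\<close>, which is the drop from
        \<open>r * j\<close> to \<open>r * i\<close>.\<close>
      moreover have "r * i < sum w (N \<inter> L)"
      proof -
        have "N = (N \<inter> L) \<union> {u \<in> N. u = v \<or> R v u}"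
          using less.prems(2) unfolding L_def by auto
        moreover have "(N \<inter> L) \<inter> {u \<in> N. u = v \<or> R v u} = {}"
          unfolding L_def by auto
        ultimately have "sum w N = sum w (N \<inter> L) + (\<Sum>u | u \<in> N \<and> (u = v \<or> R v u). w u)"
          using finN by (metis (no_types, lifting) finite_Un sum.union_disjoint)
        then show ?thesis
          using less.prems(4)[OF v(1)] less.prems(5) Suc by simp
      qed
      moreover have "chain R L i b"
        unfolding chain_def
      proof (intro allI impI)
        fix s assume "b s \<noteq> 0"
        then have s: "v \<notin> s" "c (insert v s) \<noteq> 0"
          by (auto simp: b_def split: if_splits)
        then have t: "insert v s \<subseteq> V" "indep R (insert v s)" "card (insert v s) = j"
          using less.prems(6) by (auto simp: chain_def)
        then have "finite s"
          using finV finite_subset by fastforce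
        then show "s \<subseteq> L \<and> indep R s \<and> card s = i"
          using t s Suc unfolding L_def indep_def by auto
      qed
      \<comment> \<open>Away from \<open>v\<close>, the boundary of \<open>b\<close> at
        \<open>s\<close> is the boundary of \<open>c\<close> at \<open>insert v s\<close>.\<close>
      moreover have "boundary W b s = 0" for s
      proof (cases "v \<in> s")
        case True
        then show ?thesis
          by (simp add: boundary_def b_def)
      next
        case False
        then have "boundary W b s = (\<Sum>x\<in>W - insert v s. c (insert x (insert v s)))"
          unfolding boundary_def b_def using W
          by (intro sum.mono_neutral_cong_right) (auto simp: insert_commute)
        then show ?thesis
          using less.prems(7)[of "insert v s"] by (simp add: boundary_def)
      qed
      ultimately obtain u where u: "chain R L j u" "\<And>s. boundary W u s = b s"
        using less.hyps[of L "N \<inter> L" i b] less.prems(1) LD Suc by blast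
      define c0 where "c0 = (\<lambda>s. if v \<in> s then 0 else c s)"
      have u_v: "u s = 0" if "v \<in> s" for s
        using u(1) that unfolding chain_def L_def by blast
      have c0: "chain R D j c0"
        using less.prems(6) unfolding chain_def c0_def D_def by (auto split: if_splits)
      \<comment> \<open>At a face avoiding \<open>v\<close>, the vanishing boundary of
        \<open>c\<close> splits into \<open>b\<close> and the boundary of \<open>c0\<close>.\<close>
      have bc0: "boundary W c0 s = b s" for s
      proof (cases "v \<in> s")
        case True
        then show ?thesis
          by (simp add: boundary_def c0_def b_def)
      next
        case False
        then have "boundary W c0 s = (\<Sum>x\<in>W - s - {v}. c (insert x s))"
          unfolding boundary_def c0_def using W
          by (intro sum.mono_neutral_cong_right) auto
        moreover have "boundary W c s = c (insert v s) + (\<Sum>x\<in>W - s - {v}. c (insert x s))"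
          unfolding boundary_def using W vW False by (intro sum.remove) auto
        ultimately show ?thesis
          using less.prems(7)[of s] False by (simp add: b_def bit_add_eq_0_iff)
      qed
      \<comment> \<open>As \<open>u\<close> fills \<open>b\<close> in the link,
        \<open>c0 + u\<close> is a cycle avoiding \<open>v\<close>. If \<open>y\<close> fills it,
        then \<open>y + cone v u\<close> has boundary \<open>c0 + u + u + cone v b\<close>, which is
        \<open>c\<close>.\<close>
      define z where "z = (\<lambda>s. c0 s + u s)"
      have "chain R D j z"
        unfolding z_def using c0 u(1) LD(1) by (intro chain_add) (auto intro: chain_mono)
      moreover have "boundary W z s = 0" for s
        unfolding z_def boundary_add bc0 u(2) by (simp add: bit_add_self)
      ultimately obtain y where y: "chain R D (Suc j) y" "\<And>s. boundary W y s = z s"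
        using fill_D by blast
      have "chain R V (Suc j) (\<lambda>s. y s + cone v u s)"
        using y(1) DV(1) v(1)
        by (intro chain_add chain_cone[OF R finV u(1)]) (auto simp: L_def intro: chain_mono)
      moreover have "boundary W (\<lambda>s. y s + cone v u s) s = c s" for s
      proof (cases "v \<in> s")
        case True
        then show ?thesis
          using boundary_cone_in[OF W vW True, of u] u_v[OF True]
          by (simp add: boundary_add y(2) z_def c0_def u(2) b_def insert_absorb)
      next
        case False
        then show ?thesis
          using boundary_cone_notin[OF W vW False, of u]
          by (simp add: boundary_add y(2) z_def c0_def add.assoc bit_add_self)
      qed
      ultimately show ?thesis
        by blast
    qed
  qed
qed

section \<open>Rainbow independent sets\<close>

text \<open>One colour occurs exactly twice and every other colour once; the removable vertices are
  the two of the repeated colour.\<close>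

lemma card_repeated_color_removals:
  assumes "finite s" "Suc (card (col ` s)) = card s"
  shows "card {x \<in> s. col ` (s - {x}) = col ` s} = 2"
proof -
  have "\<not> inj_on col s"
    using assms(2) card_image by fastforce
  then obtain x y where xy: "x \<in> s" "y \<in> s" "x \<noteq> y" "col x = col y"
    unfolding inj_on_def by blast
  have same: "col ` (s - {z}) = col ` s" if "z \<in> {x, y}" for z
  proof -
    have "col z \<in> col ` (s - {z})"
      using that xy by (metis Diff_iff empty_iff image_eqI insertE)
    then have "insert (col z) (col ` (s - {z})) = col ` (s - {z})"
      by blast
    moreover have "s = insert z (s - {z})"
      using that xy by blast
    ultimately show ?thesis
      by (metis image_insert)
  qed
  have inj: "inj_on col (s - {z})" if "z \<in> {x, y}" for z
  proof -
    have "col ` (s - {z}) = col ` s"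
      by (rule same[OF that])
    then have "card (col ` (s - {z})) = card (s - {z})"
      using assms that xy by auto
    then show ?thesis
      using assms(1) by (intro eq_card_imp_inj_on) auto
  qed
  have "{u \<in> s. col ` (s - {u}) = col ` s} = {x, y}"
  proof (intro equalityI subsetI)
    fix u assume "u \<in> {u \<in> s. col ` (s - {u}) = col ` s}"
    then have "u \<in> s" "col u \<in> col ` (s - {u})"
      by auto
    then obtain u' where u: "u \<in> s" "u' \<in> s" "u' \<noteq> u" "col u' = col u"
      by force
    show "u \<in> {x, y}"
    proof (rule ccontr)
      assume "u \<notin> {x, y}"
      then have "u' = x" "u' = y"
        using u xy inj_onD[OF inj[of x], of u' u] inj_onD[OF inj[of y], of u' u] by auto
      then show False
        using xy by simp
    qed
  next
    fix u assume "u \<in> {x, y}"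
    then show "u \<in> {u \<in> s. col ` (s - {u}) = col ` s}"
      using same xy(1,2) by auto
  qed
  then show ?thesis
    using xy(3) by simp
qed

text \<open>Double counting of the pairs of a face in \<open>T\<close> and a simplex with one more
  vertex.\<close>

lemma sum_boundary:
  assumes "finite W" "T \<subseteq> Pow W"
  shows "(\<Sum>t\<in>T. boundary W c t) = (\<Sum>s\<in>Pow W. of_nat (card {x \<in> s. s - {x} \<in> T}) * c s)"
proof -
  have T: "finite T" "\<And>t. t \<in> T \<Longrightarrow> finite t"
    using assms finite_subset[of _ W] finite_subset[of T "Pow W"] by auto
  have "(\<Sum>t\<in>T. boundary W c t) = (\<Sum>(t, x)\<in>Sigma T (\<lambda>t. W - t). c (insert x t))"
    unfolding boundary_def using assms T by (subst sum.Sigma) auto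
  also have "\<dots> = (\<Sum>(s, x)\<in>Sigma (Pow W) (\<lambda>s. {x \<in> s. s - {x} \<in> T}). c s)"
    using assms(2)
    by (intro sum.reindex_bij_witness[where i = "\<lambda>(s, x). (s - {x}, x)" and j = "\<lambda>(t, x). (insert x t, x)"])
      (auto simp: insert_absorb)
  also have "\<dots> = (\<Sum>s\<in>Pow W. \<Sum>x | x \<in> s \<and> s - {x} \<in> T. c s)"
    using assms(1) finite_subset[of _ W] by (subst sum.Sigma) auto
  finally show ?thesis
    by simp
qed

text \<open>A family of chains behaving like the image of the full simplex on \<open>A\<close> under a chain map
  that sends each face \<open>I\<close> into the independence complex of the vertices coloured by \<open>I\<close>.\<close>

definition carried_family ::
  "'v set \<Rightarrow> ('v \<Rightarrow> 'v \<Rightarrow> bool) \<Rightarrow> ('v \<Rightarrow> 'c) \<Rightarrow> 'c set set \<Rightarrow> ('c set \<Rightarrow> 'v set \<Rightarrow> bit) \<Rightarrow> bool" where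
  "carried_family W R col F c \<longleftrightarrow>
     (\<forall>I\<in>F. chain R {v \<in> W. col v \<in> I} (card I) (c I)) \<and>
     (\<forall>I\<in>F. I \<noteq> {} \<longrightarrow> (\<forall>s. boundary W (c I) s = (\<Sum>i\<in>I. c (I - {i}) s))) \<and>
     c {} {} = 1"

lemma
  assumes "carried_family W R col F c"
  shows carried_family_chain: "I \<in> F \<Longrightarrow> chain R {v \<in> W. col v \<in> I} (card I) (c I)"
    and carried_family_boundary: "I \<in> F \<Longrightarrow> I \<noteq> {} \<Longrightarrow> boundary W (c I) s = (\<Sum>i\<in>I. c (I - {i}) s)"
    and carried_family_empty: "c {} {} = 1"
  using assms by (auto simp: carried_family_def)

text \<open>The acyclic carrier construction, by induction on the size of faces. For a new face
  \<open>I\<close> the sum of the chains of its facets is a cycle carried by the colours in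
  \<open>I\<close>, and \<open>fill\<close> turns it into a chain for \<open>I\<close>.\<close>

lemma carried_family_exists:
  assumes W: "finite W" and A: "finite A"
    and fill: "\<And>I b. I \<subseteq> A \<Longrightarrow> I \<noteq> {} \<Longrightarrow> chain R {v \<in> W. col v \<in> I} (card I - 1) b \<Longrightarrow>
      (\<And>s. boundary W b s = 0) \<Longrightarrow>
      \<exists>u. chain R {v \<in> W. col v \<in> I} (card I) u \<and> (\<forall>s. boundary W u s = b s)"
  shows "\<exists>c. carried_family W R col {I. I \<subseteq> A \<and> card I \<le> m} c"
proof (induction m)
  case 0
  have "{I. I \<subseteq> A \<and> card I \<le> 0} = {{}}"
    using A by (auto dest: finite_subset)
  then show ?case
    by (intro exI[of _ "\<lambda>_ s. if s = {} then 1 else 0"])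
      (auto simp: carried_family_def chain_def indep_def)
next
  case (Suc m)
  then obtain c where c: "carried_family W R col {I. I \<subseteq> A \<and> card I \<le> m} c"
    by blast
  have "\<exists>u. chain R {v \<in> W. col v \<in> I} (card I) u \<and> (\<forall>s. boundary W u s = (\<Sum>i\<in>I. c (I - {i}) s))"
    if I: "I \<subseteq> A" "card I = Suc m" for I
  proof (rule fill)
    have finI: "finite I"
      using I A finite_subset by blast
    have sub: "I - {i} \<in> {I. I \<subseteq> A \<and> card I \<le> m}" if "i \<in> I" for i
      using that I finI by auto
    show "chain R {v \<in> W. col v \<in> I} (card I - 1) (\<lambda>s. \<Sum>i\<in>I. c (I - {i}) s)"
      unfolding chain_def
    proof (intro allI impI)
      fix s assume "(\<Sum>i\<in>I. c (I - {i}) s) \<noteq> 0"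
      then obtain i where i: "i \<in> I" "c (I - {i}) s \<noteq> 0"
        by (meson sum.neutral)
      then have "chain R {v \<in> W. col v \<in> I - {i}} (card (I - {i})) (c (I - {i}))"
        by (intro carried_family_chain[OF c] sub)
      then show "s \<subseteq> {v \<in> W. col v \<in> I} \<and> indep R s \<and> card s = card I - 1"
        using i finI unfolding chain_def by auto
    qed
    show "boundary W (\<lambda>s. \<Sum>i\<in>I. c (I - {i}) s) s = 0" for s
    proof (cases "m = 0")
      case True
      \<comment> \<open>The sole facet is the empty face, for which \<open>carried_family\<close>
        has no boundary equation. Its chain lives on the empty set, whereas \<open>boundary\<close>
        reads nonempty sets only.\<close>
      then obtain i where "I = {i}"
        using I card_1_singletonE by auto
      moreover have "chain R {v \<in> W. col v \<in> {}} 0 (c {})"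
        using carried_family_chain[OF c, of "{}"] by simp
      then have "c {} t = 0" if "t \<noteq> {}" for t
        using that unfolding chain_def by fastforce
      ultimately show ?thesis
        by (simp add: boundary_def)
    next
      case False
      have "boundary W (\<lambda>s. \<Sum>i\<in>I. c (I - {i}) s) s = (\<Sum>i\<in>I. boundary W (c (I - {i})) s)"
        unfolding boundary_def by (rule sum.swap)
      also have "\<dots> = (\<Sum>i\<in>I. \<Sum>j\<in>I - {i}. c (I - {i} - {j}) s)"
      proof (rule sum.cong[OF refl])
        fix i assume i: "i \<in> I"
        then have "card (I - {i}) \<noteq> 0"
          using I(2) False by simp
        then have "I - {i} \<noteq> {}"
          by force
        with i show "boundary W (c (I - {i})) s = (\<Sum>j\<in>I - {i}. c (I - {i} - {j}) s)"
          by (intro carried_family_boundary[OF c] sub)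
      qed
      also have "\<dots> = 0"
      proof (intro bit_sum_symmetric_off_diagonal finI)
        fix i j
        have "I - {i} - {j} = I - {j} - {i}"
          by blast
        then show "c (I - {i} - {j}) s = c (I - {j} - {i}) s"
          by (rule arg_cong)
      qed
      finally show ?thesis .
    qed
  qed (use I in auto)
  then have "\<forall>I\<in>{I. I \<subseteq> A \<and> card I = Suc m}. \<exists>u. chain R {v \<in> W. col v \<in> I} (card I) u \<and>
      (\<forall>s. boundary W u s = (\<Sum>i\<in>I. c (I - {i}) s))"
    by simp
  from bchoice[OF this] obtain d where d: "\<forall>I\<in>{I. I \<subseteq> A \<and> card I = Suc m}.
      chain R {v \<in> W. col v \<in> I} (card I) (d I) \<and> (\<forall>s. boundary W (d I) s = (\<Sum>i\<in>I. c (I - {i}) s))"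
    by (rule exE)
  define e where "e = (\<lambda>I. if card I \<le> m then c I else d I)"
  have e_sub: "e (I - {i}) = c (I - {i})" if "I \<subseteq> A" "card I \<le> Suc m" "i \<in> I" for I i
    using that A finite_subset[of I A] by (auto simp: e_def)
  have "carried_family W R col {I. I \<subseteq> A \<and> card I \<le> Suc m} e"
    unfolding carried_family_def
  proof (intro conjI ballI impI allI)
    fix I assume I: "I \<in> {I. I \<subseteq> A \<and> card I \<le> Suc m}"
    show "chain R {v \<in> W. col v \<in> I} (card I) (e I)"
      using carried_family_chain[OF c, of I] bspec[OF d, of I] I unfolding e_def by (auto simp: le_Suc_eq)
    fix s assume "I \<noteq> {}"
    then have "boundary W (e I) s = (\<Sum>i\<in>I. c (I - {i}) s)"
      using carried_family_boundary[OF c, of I s] bspec[OF d, of I] I unfolding e_def by auto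
    also have "\<dots> = (\<Sum>i\<in>I. e (I - {i}) s)"
      using I e_sub by (intro sum.cong) auto
    finally show "boundary W (e I) s = (\<Sum>i\<in>I. e (I - {i}) s)" .
  next
    show "e {} {} = 1"
      using c by (simp add: e_def carried_family_def)
  qed
  then show ?case
    by blast
qed

text \<open>Sperner's argument: among the faces of a simplex \<open>s\<close> coloured from \<open>I\<close>, the number of those
  with colour set exactly \<open>I - {i}\<close> is odd (namely 1) if and only if \<open>s\<close> is rainbow.\<close>

lemma carried_family_rainbow_parity:
  assumes W: "finite W" and A: "finite A" and c: "carried_family W R col (Pow A) c"
    and "I \<subseteq> A"
  shows "(\<Sum>s | s \<subseteq> W \<and> card s = card I \<and> col ` s = I. c I s) = 1"
proof -
  have "finite I"
    using assms finite_subset by blast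
  then show ?thesis
    using \<open>I \<subseteq> A\<close>
  proof (induction I rule: finite_induct)
    case empty
    have "{s. s \<subseteq> W \<and> card s = card {} \<and> col ` s = {}} = {{}}"
      by auto
    then show ?case
      using c by (simp add: carried_family_def)
  next
    case (insert i J)
    define I where "I = insert i J"
    have I: "I \<subseteq> A" "finite I" "I - {i} = J" "card I = Suc (card J)" "i \<in> I"
      using insert.hyps insert.prems unfolding I_def by auto
    have "J \<noteq> I"
      using insert.hyps(2) I(5) by blast
    \<comment> \<open>The boundary of \<open>c I\<close> is summed over the rainbow simplices with
      colour set \<open>J\<close> in two ways: by the boundary equation and by
      \<open>sum_boundary\<close>.\<close>
    define T where "T = {t. t \<subseteq> W \<and> card t = card J \<and> col ` t = J}"
    have T: "T \<subseteq> Pow W" "finite T"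
      using W unfolding T_def by auto
    have chainI: "chain R {v \<in> W. col v \<in> K} (card K) (c K)" if "K \<subseteq> I" for K
      using that I(1) by (intro carried_family_chain[OF c]) auto
    have "(\<Sum>t\<in>T. boundary W (c I) t) = (\<Sum>t\<in>T. \<Sum>j\<in>I. c (I - {j}) t)"
      using I(1,5) carried_family_boundary[OF c, of I] by (intro sum.cong) auto
    also have "\<dots> = (\<Sum>t\<in>T. c J t)"
    proof (rule sum.cong[OF refl])
      fix t assume t: "t \<in> T"
      \<comment> \<open>Such a \<open>t\<close> uses every colour of \<open>J\<close>, in particular
        \<open>j\<close>, so the facet omitting \<open>j\<close> does not carry it.\<close>
      have "c (I - {j}) t = 0" if "j \<in> I" "j \<noteq> i" for j
      proof (rule ccontr)
        assume "c (I - {j}) t \<noteq> 0"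
        then have "t \<subseteq> {v \<in> W. col v \<in> I - {j}}"
          using chainI[of "I - {j}"] unfolding chain_def by blast
        moreover have "j \<in> col ` t"
          using t that I(3) unfolding T_def by auto
        ultimately show False
          by auto
      qed
      then show "(\<Sum>j\<in>I. c (I - {j}) t) = c J t"
        using I(2,3,5) by (subst sum.remove[of I i]) (auto intro: sum.neutral)
    qed
    also have "\<dots> = 1"
      using insert.IH insert.prems unfolding T_def by simp
    finally have "(\<Sum>s\<in>Pow W. of_nat (card {x \<in> s. s - {x} \<in> T}) * c I s) = 1"
      using sum_boundary[OF W T(1)] by metis
    moreover have "of_nat (card {x \<in> s. s - {x} \<in> T}) * c I s
        = (if card s = card I \<and> col ` s = I then c I s else 0)" if s: "s \<in> Pow W" for s
    proof (cases "c I s = 0")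
      case False
      then have cs: "s \<subseteq> {v \<in> W. col v \<in> I}" "card s = card I"
        using chainI[of I] unfolding chain_def by blast+
      have fins: "finite s"
        using s W finite_subset by auto
      have mem: "{x \<in> s. s - {x} \<in> T} = {x \<in> s. col ` (s - {x}) = J}"
        using s cs(2) I(4) fins unfolding T_def by auto
      \<comment> \<open>The number of faces of \<open>s\<close> in \<open>T\<close> is 1 if
        \<open>s\<close> is rainbow, 2 if its colours are exactly \<open>J\<close>, and 0 otherwise.
        Only the first case survives modulo 2.\<close>
      consider "col ` s = I" | "col ` s = J" | "col ` s \<noteq> I" "col ` s \<noteq> J"
        by blast
      then show ?thesis
      proof cases
        case 1
        then have inj: "inj_on col s"
          using fins cs(2) by (simp add: eq_card_imp_inj_on)
        obtain x where x: "x \<in> s" "col x = i"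
          using 1 I(5) by auto
        have "{x \<in> s. col ` (s - {x}) = J} = {x}"
        proof (intro equalityI subsetI)
          fix y assume "y \<in> {x \<in> s. col ` (s - {x}) = J}"
          then have y: "y \<in> s" "col ` (s - {y}) = J"
            by auto
          have "i \<notin> J"
            by (rule insert.hyps)
          then have "x \<notin> s - {y}"
            using y x by blast
          then show "y \<in> {x}"
            using x by auto
        next
          fix y assume "y \<in> {x}"
          then show "y \<in> {x \<in> s. col ` (s - {x}) = J}"
            using x inj_on_image_set_diff[OF inj, of s "{x}"] 1 insert.hyps(2) I_def by auto
        qed
        then show ?thesis
          using mem 1 cs(2) by simp
      next
        case 2
        then have "card {x \<in> s. col ` (s - {x}) = J} = 2"
          using card_repeated_color_removals[OF fins, of col] cs(2) I(4) by simp
        then show ?thesis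
          using mem 2 \<open>J \<noteq> I\<close> by simp
      next
        case 3
        have "{x \<in> s. col ` (s - {x}) = J} = {}"
        proof (rule ccontr)
          assume "{x \<in> s. col ` (s - {x}) = J} \<noteq> {}"
          then have "J \<subseteq> col ` s"
            by auto
          then have "col ` s = J \<or> col ` s = I"
            using cs(1) I_def by auto
          then show False
            using 3 by blast
        qed
        then have "card {x \<in> s. s - {x} \<in> T} = 0"
          by (simp only: mem card.empty)
        then show ?thesis
          using 3 by (simp only: of_nat_0 mult_zero_left if_False simp_thms)
      qed
    qed auto
    ultimately have "(\<Sum>s\<in>Pow W. if card s = card I \<and> col ` s = I then c I s else 0) = 1"
      by simp
    moreover have "(\<Sum>s\<in>Pow W. if card s = card I \<and> col ` s = I then c I s else 0)
        = (\<Sum>s | s \<subseteq> W \<and> card s = card I \<and> col ` s = I. c I s)"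
      using W by (subst sum.inter_filter[symmetric]) (auto intro!: sum.cong)
    ultimately show ?case
      unfolding I_def by simp
  qed
qed

text \<open>A topological form of Hall's theorem. \<open>N I\<close> and \<open>w I\<close> certify
  through \<open>independence_complex_filling\<close> that cycles of size \<open>card I - 1\<close>
  in the colours \<open>I\<close> bound, so a carried family on \<open>Pow A\<close> exists; by
  parity its top chain is nonzero on a simplex with all colours. General weights serve the
  deficiency form.\<close>

lemma rainbow_independent_set:
  fixes w :: "'c set \<Rightarrow> 'v \<Rightarrow> nat"
  assumes W: "finite W" and A: "finite A" and R: "symp R"
    and N: "\<And>I. I \<subseteq> A \<Longrightarrow> I \<noteq> {} \<Longrightarrow> N I \<subseteq> {v \<in> W. col v \<in> I} \<and> indep R (N I)"
    and le: "\<And>I v. I \<subseteq> A \<Longrightarrow> I \<noteq> {} \<Longrightarrow> v \<in> W \<Longrightarrow> col v \<in> I \<Longrightarrow>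
      (\<Sum>u | u \<in> N I \<and> (u = v \<or> R v u). w I u) \<le> r"
    and less: "\<And>I. I \<subseteq> A \<Longrightarrow> I \<noteq> {} \<Longrightarrow> r * (card I - 1) < sum (w I) (N I)"
  shows "\<exists>s \<subseteq> W. indep R s \<and> inj_on col s \<and> col ` s = A"
proof -
  have "\<exists>c. carried_family W R col {I. I \<subseteq> A \<and> card I \<le> card A} c"
  proof (rule carried_family_exists[OF W A])
    fix I b
    assume I: "I \<subseteq> A" "I \<noteq> {}" and b: "chain R {v \<in> W. col v \<in> I} (card I - 1) b"
      "\<And>s. boundary W b s = 0"
    have "Suc (card I - 1) = card I"
      using I A finite_subset card_gt_0_iff by (metis Suc_diff_1)
    then show "\<exists>u. chain R {v \<in> W. col v \<in> I} (card I) u \<and> (\<forall>s. boundary W u s = b s)"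
      using independence_complex_filling[OF W R _ _ _ _ less[OF I] b] N[OF I] le[OF I] by auto
  qed
  moreover have "{I. I \<subseteq> A \<and> card I \<le> card A} = Pow A"
    using A card_mono by auto
  ultimately obtain c where c: "carried_family W R col (Pow A) c"
    by auto
  then have "(\<Sum>s | s \<subseteq> W \<and> card s = card A \<and> col ` s = A. c A s) \<noteq> 0"
    using carried_family_rainbow_parity[OF W A c order_refl] by simp
  then obtain s where s: "s \<subseteq> W" "card s = card A" "col ` s = A" "c A s \<noteq> 0"
    by (metis (mono_tags, lifting) mem_Collect_eq sum.neutral)
  then have "indep R s"
    using carried_family_chain[OF c, of A] unfolding chain_def by blast
  moreover have "inj_on col s"
    using s finite_subset[OF s(1) W] by (intro eq_card_imp_inj_on) auto
  ultimately show ?thesis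
    using s by blast
qed

text \<open>A full rainbow set of an enlarged graph contains at most \<open>d\<close> auxiliary
  vertices, since two with the same index conflict. Discarding them loses at most \<open>d\<close>
  colours.\<close>

lemma rainbow_independent_set_deficiency:
  fixes col :: "'v \<Rightarrow> 'c"
  assumes W: "finite W" and A: "finite A" and R: "symp R"
    and ex: "\<And>I. I \<subseteq> A \<Longrightarrow> I \<noteq> {} \<Longrightarrow> \<exists>N \<subseteq> {v \<in> W. col v \<in> I}. indep R N \<and>
      (\<forall>v\<in>W. col v \<in> I \<longrightarrow> card {u \<in> N. u = v \<or> R v u} \<le> r) \<and>
      r * (card I - 1) < card N + r * d"
  shows "\<exists>s \<subseteq> W. indep R s \<and> inj_on col s \<and> card A \<le> card s + d"
proof -
  define good where "good = (\<lambda>I N. N \<subseteq> {v \<in> W. col v \<in> I} \<and> indep R N \<and>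
      (\<forall>v\<in>W. col v \<in> I \<longrightarrow> card {u \<in> N. u = v \<or> R v u} \<le> r) \<and>
      r * (card I - 1) < card N + r * d)"
  have "\<forall>I\<in>{I. I \<subseteq> A \<and> I \<noteq> {}}. \<exists>N. good I N"
    using ex unfolding good_def by simp
  from bchoice[OF this] obtain N where "\<forall>I\<in>{I. I \<subseteq> A \<and> I \<noteq> {}}. good I (N I)"
    by (rule exE)
  then have N: "N I \<subseteq> {v \<in> W. col v \<in> I} \<and> indep R (N I) \<and>
      (\<forall>v\<in>W. col v \<in> I \<longrightarrow> card {u \<in> N I. u = v \<or> R v u} \<le> r) \<and>
      r * (card I - 1) < card (N I) + r * d" if "I \<subseteq> A" "I \<noteq> {}" for I
    using that unfolding good_def by simp
  \<comment> \<open>Add \<open>d\<close> new pairwise compatible resources, each usable by one vertex of every colour. A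
    resource enters with weight \<open>r\<close>, so it raises the connectivity by one.\<close>
  define W' where "W' = W <+> (A \<times> {..<d})"
  define col' :: "'v + 'c \<times> nat \<Rightarrow> 'c" where "col' = case_sum col fst"
  define R' :: "'v + 'c \<times> nat \<Rightarrow> 'v + 'c \<times> nat \<Rightarrow> bool" where "R' = (\<lambda>x y. case (x, y) of (Inl u, Inl v) \<Rightarrow> R u v
      | (Inr p, Inr q) \<Rightarrow> snd p = snd q | _ \<Rightarrow> False)"
  define w :: "'v + 'c \<times> nat \<Rightarrow> nat" where "w = case_sum (\<lambda>_. 1) (\<lambda>_. r)"
  \<comment> \<open>One vertex per auxiliary resource keeps \<open>N' I\<close> independent; any
    colour from \<open>I\<close> would do.\<close>
  define N' where "N' = (\<lambda>I. N I <+> ({SOME a. a \<in> I} \<times> {..<d}))"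
  have "\<exists>s \<subseteq> W'. indep R' s \<and> inj_on col' s \<and> col' ` s = A"
  proof (rule rainbow_independent_set[where N = N' and w = "\<lambda>_. w" and r = r])
    show "finite W'"
      using W A by (simp add: W'_def)
    show "symp R'"
      using R unfolding symp_def R'_def by (auto split: sum.splits)
    fix I assume I: "I \<subseteq> A" "I \<noteq> {}"
    have NI: "N I \<subseteq> {v \<in> W. col v \<in> I}" "indep R (N I)"
      using N[OF I] by auto
    have finN: "finite (N I)"
      using NI(1) W finite_subset by fastforce
    have some: "(SOME a. a \<in> I) \<in> I"
      using I(2) by (simp add: some_in_eq)
    show "N' I \<subseteq> {v \<in> W'. col' v \<in> I} \<and> indep R' (N' I)"
      using NI some I(1) unfolding N'_def W'_def col'_def R'_def indep_def
      by (auto; blast)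
    have "sum w (N' I) = card (N I) + r * d"
      unfolding N'_def using finN by (simp add: sum.Plus w_def)
    then show "r * (card I - 1) < sum w (N' I)"
      using N[OF I] by simp
    fix v assume v: "v \<in> W'" "col' v \<in> I"
    show "(\<Sum>u | u \<in> N' I \<and> (u = v \<or> R' v u). w u) \<le> r"
    proof (cases v)
      case (Inl x)
      then have "{u. u \<in> N' I \<and> (u = v \<or> R' v u)} = Inl ` {u \<in> N I. u = x \<or> R x u}"
        unfolding N'_def R'_def by auto
      then have "(\<Sum>u | u \<in> N' I \<and> (u = v \<or> R' v u). w u) = card {u \<in> N I. u = x \<or> R x u}"
        by (simp add: sum.reindex w_def)
      then show ?thesis
        using N[OF I] v Inl by (auto simp: W'_def col'_def)
    next
      case (Inr p)
      have "(\<Sum>u | u \<in> N' I \<and> (u = v \<or> R' v u). w u) \<le> sum w {Inr (SOME a. a \<in> I, snd p)}"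
        using Inr by (intro sum_mono2) (auto simp: N'_def R'_def)
      then show ?thesis
        by (simp add: w_def)
    qed
  qed (rule A)
  then obtain s where s: "s \<subseteq> W'" "indep R' s" "inj_on col' s" "col' ` s = A"
    by blast
  define t where "t = Inl -` s"
  define q where "q = Inr -` s"
  have st: "s = t <+> q"
  proof (intro set_eqI)
    show "x \<in> s \<longleftrightarrow> x \<in> t <+> q" for x
      by (cases x) (auto simp: t_def q_def)
  qed
  have fins: "finite s"
    using finite_subset[OF s(1)] W A by (simp add: W'_def)
  then have fin: "finite t" "finite q"
    using st by auto
  have "inj_on snd q"
  proof (rule inj_onI)
    fix x y assume "x \<in> q" "y \<in> q" "snd x = snd y"
    then show "x = y"
      using s(2) unfolding q_def indep_def R'_def by fastforce
  qed
  moreover have "snd ` q \<subseteq> {..<d}"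
    using s(1) unfolding q_def W'_def by auto
  ultimately have "card q \<le> d"
    using card_mono[of "{..<d}" "snd ` q"] card_image[of snd q] by simp
  moreover have "card A = card t + card q"
    using s(3,4) card_image[of col' s] st fin card_Plus by metis
  moreover have "t \<subseteq> W"
    using s(1) unfolding t_def W'_def by auto
  moreover have "indep R t"
    unfolding indep_def
  proof (intro ballI impI)
    fix x y assume "x \<in> t" "y \<in> t" "x \<noteq> y"
    then have "\<not> R' (Inl x) (Inl y)"
      using s(2) unfolding indep_def t_def by blast
    then show "\<not> R x y"
      by (simp add: R'_def)
  qed
  moreover have "inj_on col t"
  proof (rule inj_onI)
    fix x y assume "x \<in> t" "y \<in> t" "col x = col y"
    then show "x = y"
      using inj_onD[OF s(3), of "Inl x" "Inl y"] by (simp add: t_def col'_def)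
  qed
  ultimately show ?thesis
    by (metis add_le_cancel_left)
qed

section \<open>Fractional matchings in two- and three-partite hypergraphs\<close>

text \<open>Hall's theorem with deficiency: \<open>p\<close>-ends are colours, and edges sharing a
  \<open>q\<close>-end conflict. Colours outside \<open>J\<close> carry weight at most 1 each, so
  the edges over \<open>J\<close> have weight at least \<open>sum f E - (card B - card J)\<close>
  and hence at least that many \<open>q\<close>-ends.\<close>

lemma bipartite_fractional_matching:
  fixes f :: "'e \<Rightarrow> real"
  assumes E: "finite E" and f: "\<And>e. e \<in> E \<Longrightarrow> 0 \<le> f e"
    and p: "\<And>x. (\<Sum>e | e \<in> E \<and> p e = x. f e) \<le> 1"
    and q: "\<And>y. (\<Sum>e | e \<in> E \<and> q e = y. f e) \<le> 1"
  shows "\<exists>M \<subseteq> E. inj_on p M \<and> inj_on q M \<and> sum f E \<le> card M"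
proof -
  define B where "B = p ` E"
  define R where "R = (\<lambda>x y. q x = q y)"
  have B: "finite B"
    using E by (simp add: B_def)
  have sum_p: "sum f {e \<in> E. p e \<in> J} = (\<Sum>x\<in>J. \<Sum>e | e \<in> E \<and> p e = x. f e)" if "finite J" for J
  proof -
    have "(\<Sum>x\<in>J. \<Sum>e | e \<in> {e \<in> E. p e \<in> J} \<and> p e = x. f e) = sum f {e \<in> E. p e \<in> J}"
      using that E by (intro sum.group) auto
    moreover have "{e. e \<in> {e \<in> E. p e \<in> J} \<and> p e = x} = {e \<in> E. p e = x}" if "x \<in> J" for x
      using that by auto
    ultimately show ?thesis
      by simp
  qed
  have EB: "{e \<in> E. p e \<in> B} = E"
    by (auto simp: B_def)
  have fE: "sum f E \<le> card B"
  proof -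
    have "sum f E = (\<Sum>x\<in>B. \<Sum>e | e \<in> E \<and> p e = x. f e)"
      using sum_p[OF B] EB by simp
    also have "\<dots> \<le> (\<Sum>x\<in>B. 1)"
      by (intro sum_mono p)
    finally show ?thesis
      by simp
  qed
  \<comment> \<open>The tolerated number of missing colours. Rounding down keeps
    \<open>card B - d \<ge> sum f E\<close>; the loss is below 1 and is absorbed by the
    \<open>card J - 1\<close> in the rainbow condition.\<close>
  define d where "d = nat \<lfloor>card B - sum f E\<rfloor>"
  have d: "real d \<le> card B - sum f E" "card B - sum f E < real d + 1"
    using fE unfolding d_def by linarith+
  have "\<exists>s \<subseteq> E. indep R s \<and> inj_on p s \<and> card B \<le> card s + d"
  proof (rule rainbow_independent_set_deficiency[OF E B, where r = 1])
    show "symp R"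
      by (auto simp: symp_def R_def)
    fix J assume J: "J \<subseteq> B" "J \<noteq> {}"
    then have finJ: "finite J"
      using B finite_subset by blast
    define F where "F = {e \<in> E. p e \<in> J}"
    \<comment> \<open>One edge for each \<open>q\<close>-end met by \<open>F\<close>. Sharing a
      \<open>q\<close>-end is an equivalence relation, so an edge equals or conflicts with at most
      one member of \<open>N\<close>, whence \<open>r = 1\<close>.\<close>
    obtain N where N: "N \<subseteq> F" "q ` N = q ` F" "inj_on q N"
      using subset_image_inj[of "q ` F" q F] by auto
    have finF: "finite F"
      using E by (simp add: F_def)
    then have finN: "finite N"
      using N(1) finite_subset by blast
    have "sum f F = (\<Sum>y\<in>q ` F. \<Sum>e | e \<in> F \<and> q e = y. f e)"
      using finF by (intro sum.group[symmetric]) auto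
    also have "\<dots> \<le> (\<Sum>y\<in>q ` F. 1)"
    proof (rule sum_mono)
      fix y
      have "(\<Sum>e | e \<in> F \<and> q e = y. f e) \<le> (\<Sum>e | e \<in> E \<and> q e = y. f e)"
        using E f by (intro sum_mono2) (auto simp: F_def)
      then show "(\<Sum>e | e \<in> F \<and> q e = y. f e) \<le> 1"
        using q[of y] by simp
    qed
    also have "\<dots> = card N"
      using N(2,3) card_image by fastforce
    finally have fF: "sum f F \<le> card N" .
    have "sum f E - sum f F \<le> real (card B) - card J"
    proof -
      have "sum f E = (\<Sum>x\<in>B - J. \<Sum>e | e \<in> E \<and> p e = x. f e) + sum f F"
        using sum_p[OF B] sum_p[OF finJ] EB sum.subset_diff[OF J(1) B] unfolding F_def by simp
      moreover have "(\<Sum>x\<in>B - J. \<Sum>e | e \<in> E \<and> p e = x. f e) \<le> (\<Sum>x\<in>B - J. 1)"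
        by (intro sum_mono p)
      moreover have "(\<Sum>x\<in>B - J. 1) = real (card B) - card J"
        using J(1) B finJ by (simp add: card_Diff_subset card_mono of_nat_diff)
      ultimately show ?thesis
        by linarith
    qed
    then have "real (card J) < card N + d + 1"
      using fF d by linarith
    moreover have "card J \<noteq> 0"
      using J(2) finJ by simp
    ultimately have "1 * (card J - 1) < card N + 1 * d"
      by linarith
    moreover have "indep R N"
      using N(3) by (auto simp: indep_def R_def inj_on_def)
    moreover have "card {u \<in> N. u = v \<or> R v u} \<le> 1" for v
    proof -
      have "x = y" if "x \<in> {u \<in> N. u = v \<or> R v u}" "y \<in> {u \<in> N. u = v \<or> R v u}" for x y
        using that N(3) unfolding R_def by (auto dest: inj_onD)
      then show ?thesis
        using finN by (simp add: card_le_Suc0_iff_eq)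
    qed
    ultimately show "\<exists>N \<subseteq> {v \<in> E. p v \<in> J}. indep R N \<and>
        (\<forall>v\<in>E. p v \<in> J \<longrightarrow> card {u \<in> N. u = v \<or> R v u} \<le> 1) \<and> 1 * (card J - 1) < card N + 1 * d"
      using N(1) unfolding F_def by blast
  qed
  then obtain s where s: "s \<subseteq> E" "indep R s" "inj_on p s" "card B \<le> card s + d"
    by blast
  moreover have "inj_on q s"
    using s(2) by (auto simp: indep_def R_def inj_on_def)
  moreover have "sum f E \<le> card s"
    using s(4) d(1) by linarith
  ultimately show ?thesis
    by blast
qed

text \<open>Colours are the \<open>a\<close>-vertices. The certificate for \<open>I\<close> is a
  matching \<open>N\<close> of at least \<open>card I * n / k\<close> edges in the bipartite link
  graph; an edge meets at most two of them, at its \<open>b\<close>-end and at its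
  \<open>c\<close>-end, whence \<open>r = 2\<close>.\<close>

lemma tripartite_fractional_matching:
  fixes f :: "'e \<Rightarrow> real" and k n :: nat
  assumes E: "finite E" and f: "\<And>e. e \<in> E \<Longrightarrow> 0 \<le> f e"
    and A: "finite A" "card A = k" "0 < k"
    and a: "\<And>x. x \<in> A \<Longrightarrow> (\<Sum>e | e \<in> E \<and> a e = x. f e) = n / k"
    and b: "\<And>x. (\<Sum>e | e \<in> E \<and> b e = x. f e) \<le> 1"
    and c: "\<And>x. (\<Sum>e | e \<in> E \<and> c e = x. f e) \<le> 1"
  shows "\<exists>M \<subseteq> E. inj_on a M \<and> inj_on b M \<and> inj_on c M \<and> min k (nat \<lceil>real n / 2\<rceil>) \<le> card M"
proof -
  define m where "m = min k (nat \<lceil>real n / 2\<rceil>)"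
  define R where "R = (\<lambda>x y. b x = b y \<or> c x = c y)"
  have m: "m \<le> k" "real m < real n / 2 + 1"
    unfolding m_def by linarith+
  have "\<exists>s \<subseteq> E. indep R s \<and> inj_on a s \<and> card A \<le> card s + (k - m)"
  proof (rule rainbow_independent_set_deficiency[OF E A(1), where r = 2])
    show "symp R"
      by (auto simp: symp_def R_def)
    fix I assume I: "I \<subseteq> A" "I \<noteq> {}"
    then have finI: "finite I"
      using A finite_subset by blast
    define F where "F = {e \<in> E. a e \<in> I}"
    have finF: "finite F" "F \<subseteq> E"
      using E by (auto simp: F_def)
    have sub: "(\<Sum>e | e \<in> F \<and> g e = x. f e) \<le> (\<Sum>e | e \<in> E \<and> g e = x. f e)" for g :: "'e \<Rightarrow> 'z" and x
      using E f by (intro sum_mono2) (auto simp: F_def)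
    have "\<exists>M \<subseteq> F. inj_on b M \<and> inj_on c M \<and> sum f F \<le> card M"
      using finF f order_trans[OF sub b] order_trans[OF sub c]
      by (intro bipartite_fractional_matching) auto
    then obtain N where N: "N \<subseteq> F" "inj_on b N" "inj_on c N" "sum f F \<le> card N"
      by blast
    have finN: "finite N"
      using N(1) finF(1) finite_subset by blast
    have "sum f F = (\<Sum>x\<in>I. \<Sum>e | e \<in> F \<and> a e = x. f e)"
      using finF finI by (intro sum.group[symmetric]) (auto simp: F_def)
    also have "\<dots> = (\<Sum>x\<in>I. n / k)"
    proof (rule sum.cong[OF refl])
      fix x assume x: "x \<in> I"
      then have "{e. e \<in> F \<and> a e = x} = {e. e \<in> E \<and> a e = x}"
        by (auto simp: F_def)
      then show "(\<Sum>e | e \<in> F \<and> a e = x. f e) = n / k"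
        using a x I(1) by auto
    qed
    finally have cN: "card I * n / k \<le> card N"
      using N(4) by simp
    have "card I \<noteq> 0" "card I \<le> k"
      using I finI A card_mono by auto
    \<comment> \<open>If \<open>n \<ge> 2 * k\<close>, then already
      \<open>card N \<ge> 2 * card I\<close>. Otherwise \<open>I = A\<close> is the worst case, with
      deficit \<open>2 * k - n\<close>, and \<open>2 * m < n + 2\<close> suffices thanks to the
      \<open>- 1\<close>; this permits rounding \<open>n / 2\<close> up.\<close>
    have "2 * (real (card I) - 1) < card N + 2 * (real k - m)"
    proof (cases "real n \<ge> 2 * k")
      case True
      then have "real n / k \<ge> 2"
        using A(3) by (simp add: pos_le_divide_eq)
      then have "real (card I) * (n / k) \<ge> real (card I) * 2"
        by (intro mult_left_mono) auto
      then show ?thesis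
        using cN m(1) by simp
    next
      case False
      have "card I * (2 - n / k) \<le> k * (2 - n / k)"
        using \<open>card I \<le> k\<close> False A(3) by (intro mult_right_mono) (auto simp: field_simps)
      also have "\<dots> = 2 * k - real n"
        using A(3) by (simp add: field_simps)
      finally show ?thesis
        using cN m(2) by (simp add: algebra_simps)
    qed
    moreover have "real (card I) - 1 = real (card I - 1)" "real k - m = real (k - m)"
      using m(1) \<open>card I \<noteq> 0\<close> by auto
    ultimately have "real (2 * (card I - 1)) < real (card N + 2 * (k - m))"
      by (simp only: of_nat_add of_nat_mult of_nat_numeral)
    then have "2 * (card I - 1) < card N + 2 * (k - m)"
      by (simp only: of_nat_less_iff)
    moreover have "indep R N"
      using N(2,3) by (auto simp: indep_def R_def inj_on_def)
    moreover have "card {u \<in> N. u = v \<or> R v u} \<le> 2" for v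
    proof -
      have one: "card {u \<in> N. g u = g v} \<le> 1" if "inj_on g N" for g :: "'e \<Rightarrow> 'z"
        using finN that by (simp add: card_le_Suc0_iff_eq inj_on_def)
      have "{u \<in> N. u = v \<or> R v u} = {u \<in> N. b u = b v} \<union> {u \<in> N. c u = c v}"
        by (auto simp: R_def)
      then have "card {u \<in> N. u = v \<or> R v u} \<le> card {u \<in> N. b u = b v} + card {u \<in> N. c u = c v}"
        by (simp only: card_Un_le)
      then show ?thesis
        using one[OF N(2)] one[OF N(3)] by linarith
    qed
    ultimately show "\<exists>N \<subseteq> {v \<in> E. a v \<in> I}. indep R N \<and>
        (\<forall>v\<in>E. a v \<in> I \<longrightarrow> card {u \<in> N. u = v \<or> R v u} \<le> 2) \<and>
        2 * (card I - 1) < card N + 2 * (k - m)"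
      using N(1) unfolding F_def by blast
  qed
  then obtain s where s: "s \<subseteq> E" "indep R s" "inj_on a s" "card A \<le> card s + (k - m)"
    by blast
  moreover have "inj_on b s" "inj_on c s"
    using s(2) by (auto simp: indep_def R_def inj_on_def)
  moreover have "m \<le> card s"
    using s(4) A(2) m(1) by simp
  ultimately show ?thesis
    unfolding m_def by blast
qed

section \<open>Edges of a partite hypergraph as tuples of vertices, and their degrees\<close>

definition side_vertex :: "'a set list \<Rightarrow> nat \<Rightarrow> 'a set \<Rightarrow> 'a" where
  "side_vertex Vs t e = the_elem (e \<inter> Vs ! t)"

lemma partite_inter_side:
  assumes "partite Vs H" "e \<in> H" "t < length Vs"
  shows "e \<inter> Vs ! t = {side_vertex Vs t e}"
proof -
  have "card (e \<inter> Vs ! t) = 1"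
    using assms by (auto simp: partite_def)
  then show ?thesis
    unfolding side_vertex_def by (metis card_1_singletonE the_elem_eq)
qed

lemma partite_side_vertex_eq_iff:
  assumes "partite Vs H" "e \<in> H" "t < length Vs" "x \<in> Vs ! t"
  shows "side_vertex Vs t e = x \<longleftrightarrow> x \<in> e"
proof -
  have "x \<in> e \<inter> Vs ! t \<longleftrightarrow> x \<in> {side_vertex Vs t e}"
    by (simp only: partite_inter_side[OF assms(1-3)])
  then show ?thesis
    using assms(4) by auto
qed

text \<open>Edges lie in the union of the sides, so a common vertex would be the vertex of both
  edges on some side.\<close>

lemma partite_disjoint_if_inj_on:
  assumes H: "partite Vs H" and "M \<subseteq> H"
    and inj: "\<And>t. t < length Vs \<Longrightarrow> inj_on (side_vertex Vs t) M"
  shows "disjoint M"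
proof (rule disjointI)
  fix e e' assume e: "e \<in> M" "e' \<in> M" "e \<noteq> e'"
  then have eH: "e \<in> H" "e' \<in> H"
    using assms(2) by auto
  show "e \<inter> e' = {}"
  proof (rule ccontr)
    assume "e \<inter> e' \<noteq> {}"
    then obtain x where x: "x \<in> e" "x \<in> e'"
      by blast
    then obtain t where t: "t < length Vs" "x \<in> Vs ! t"
      using H eH(1) unfolding partite_def by (metis UnionE in_set_conv_nth subsetD)
    have "side_vertex Vs t e = side_vertex Vs t e'"
      using partite_side_vertex_eq_iff[OF H _ t] eH x by metis
    then show False
      using inj[OF t(1)] e by (auto dest: inj_onD)
  qed
qed

lemma partite_sum_side_vertex:
  assumes "partite Vs H" "t < length Vs" "x \<in> Vs ! t"
  shows "(\<Sum>e | e \<in> H \<and> side_vertex Vs t e = x. f e) = deg H f x"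
  unfolding deg_def using partite_side_vertex_eq_iff[OF assms(1) _ assms(2,3)]
  by (intro sum.cong) auto

lemma partite_sum_deg:
  assumes "partite Vs H" "t < length Vs" "finite (Vs ! t)"
  shows "(\<Sum>x\<in>Vs ! t. deg H f x) = sum f H"
proof -
  have "(\<Sum>x\<in>Vs ! t. deg H f x) = (\<Sum>x\<in>Vs ! t. \<Sum>e | e \<in> H \<and> side_vertex Vs t e = x. f e)"
    using partite_sum_side_vertex[OF assms(1,2)] by simp
  also have "\<dots> = sum f H"
  proof (rule sum.group)
    show "side_vertex Vs t ` H \<subseteq> Vs ! t"
      using partite_inter_side[OF assms(1) _ assms(2)] by blast
  qed (use assms in \<open>auto simp: partite_def\<close>)
  finally show ?thesis .
qed

text \<open>Each edge has one vertex on side \<open>t\<close>, so the degrees there sum to the total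
  weight; balance makes them equal.\<close>

lemma balanced_deg:
  assumes "partite Vs H" "balanced Vs H f" "t < length Vs" "finite (Vs ! t)" "x \<in> Vs ! t"
  shows "deg H f x = sum f H / card (Vs ! t)"
proof -
  have "(\<Sum>y\<in>Vs ! t. deg H f y) = (\<Sum>y\<in>Vs ! t. deg H f x)"
  proof (rule sum.cong[OF refl])
    show "deg H f y = deg H f x" if "y \<in> Vs ! t" for y
      using assms that unfolding balanced_def by blast
  qed
  then have "card (Vs ! t) * deg H f x = sum f H"
    using partite_sum_deg[OF assms(1,3,4), of f] by simp
  moreover have "card (Vs ! t) \<noteq> 0"
    using assms(4,5) by auto
  ultimately show ?thesis
    by (auto simp: field_simps)
qed

lemma fractionally_balanced_matching:
  fixes Vs :: "'a set list"
  assumes "0 < k" "0 < n" and fb: "fractionally_balanced [k, n, n] Vs H"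
  shows "\<exists>M. matching H M \<and> card M = min k (nat \<lceil>real n / 2\<rceil>)"
proof -
  obtain f where H: "partite Vs H" and len: "length Vs = 3"
    and V: "\<And>t. t < 3 \<Longrightarrow> finite (Vs ! t) \<and> card (Vs ! t) = [k, n, n] ! t"
    and f: "\<And>e. e \<in> H \<Longrightarrow> 0 \<le> f e" "\<exists>e\<in>H. f e \<noteq> 0" "balanced Vs H f"
    using fb unfolding fractionally_balanced_def by auto
  have finH: "finite H"
    using H by (simp add: partite_def)
  have pos: "0 < sum f H"
    using f finH by (metis less_eq_real_def sum_pos2)
  \<comment> \<open>Normalised to total weight \<open>n\<close>: degrees become 1 on the sides of
    size \<open>n\<close> and \<open>n / k\<close> on the side of size \<open>k\<close>.\<close>
  define g where "g = (\<lambda>e. n / sum f H * f e)"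
  have g: "(\<Sum>e | e \<in> H \<and> side_vertex Vs t e = x. g e) = n / ([k, n, n] ! t)"
    if t: "t < 3" and x: "x \<in> Vs ! t" for t x
  proof -
    have "(\<Sum>e | e \<in> H \<and> side_vertex Vs t e = x. g e) = n / sum f H * deg H f x"
      unfolding g_def sum_distrib_left[symmetric]
      using partite_sum_side_vertex[OF H, of t x f] t x len by simp
    then show ?thesis
      using balanced_deg[OF H f(3), of t x] V[OF t] t x len pos by simp
  qed
  have g_le: "(\<Sum>e | e \<in> H \<and> side_vertex Vs t e = x. g e) \<le> 1" if t: "t = 1 \<or> t = 2" for t x
  proof (cases "x \<in> Vs ! t")
    case True
    then show ?thesis
      using g[of t x] t \<open>0 < n\<close> by auto
  next
    case False
    \<comment> \<open>The bound is wanted for every \<open>x\<close>; off side \<open>t\<close> the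
      sum is empty.\<close>
    have "{e. e \<in> H \<and> side_vertex Vs t e = x} = {}"
      using partite_inter_side[OF H, of _ t] t len False by fastforce
    then show ?thesis
      by (simp only: sum.empty)
  qed
  have "\<exists>M \<subseteq> H. inj_on (side_vertex Vs 0) M \<and> inj_on (side_vertex Vs 1) M \<and>
      inj_on (side_vertex Vs 2) M \<and> min k (nat \<lceil>real n / 2\<rceil>) \<le> card M"
  proof (rule tripartite_fractional_matching[OF finH _ _ _ \<open>0 < k\<close>])
    show "0 \<le> g e" if "e \<in> H" for e
      using f(1)[OF that] pos by (simp add: g_def)
    show "finite (Vs ! 0)" "card (Vs ! 0) = k"
      using V[of 0] by auto
    show "(\<Sum>e | e \<in> H \<and> side_vertex Vs 0 e = x. g e) = n / k" if "x \<in> Vs ! 0" for x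
      using g[of 0 x] that by simp
  qed (use g_le in auto)
  then obtain M where M: "M \<subseteq> H" "\<And>t. t < 3 \<Longrightarrow> inj_on (side_vertex Vs t) M"
    and le: "min k (nat \<lceil>real n / 2\<rceil>) \<le> card M"
    by (auto simp: less_Suc_eq numeral_3_eq_3 numeral_2_eq_2)
  \<comment> \<open>The size must be met exactly, and injectivity on the sides passes to
    subsets.\<close>
  obtain M' where M': "M' \<subseteq> M" "card M' = min k (nat \<lceil>real n / 2\<rceil>)"
    using obtain_subset_with_card_n[OF le] by metis
  have "disjoint M'"
  proof (rule partite_disjoint_if_inj_on[OF H])
    show "inj_on (side_vertex Vs t) M'" if "t < length Vs" for t
      using inj_on_subset[OF M(2) M'(1)] that len by simp
  qed (use M(1) M'(1) in blast)
  then show ?thesis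
    using M M' unfolding matching_def by blast
qed

section \<open>The complete tripartite hypergraph, and the passage to \<open>bm\<close>\<close>

lemma fractionally_balanced_exists:
  assumes "0 < k" "0 < n"
  shows "\<exists>(Vs :: nat set list) H. fractionally_balanced [k, n, n] Vs H"
proof -
  define A B C where "A = {..<k}" and "B = {k..<k + n}" and "C = {k + n..<k + n + n}"
  define tr where "tr = (\<lambda>(a, b, c). {a, b, c :: nat})"
  define H where "H = tr ` (A \<times> B \<times> C)"
  have disj: "A \<inter> B = {}" "A \<inter> C = {}" "B \<inter> C = {}"
    by (auto simp: A_def B_def C_def)
  have fin: "finite A" "finite B" "finite C"
    by (auto simp: A_def B_def C_def)
  have meet: "tr (a, b, c) \<inter> A = {a}" "tr (a, b, c) \<inter> B = {b}" "tr (a, b, c) \<inter> C = {c}"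
    if "a \<in> A" "b \<in> B" "c \<in> C" for a b c
    using that disj by (auto simp: tr_def)
  have inj: "inj_on tr (A \<times> B \<times> C)"
  proof (rule inj_onI)
    fix p p' assume "p \<in> A \<times> B \<times> C" "p' \<in> A \<times> B \<times> C" and eq: "tr p = tr p'"
    then obtain a b c a' b' c' where p: "p = (a, b, c)" "p' = (a', b', c')"
      and *: "a \<in> A" "b \<in> B" "c \<in> C" "a' \<in> A" "b' \<in> B" "c' \<in> C"
      by auto
    have "{a} = {a'}" "{b} = {b'}" "{c} = {c'}"
      using meet[OF *(1-3)] meet[OF *(4-6)] eq unfolding p by simp_all
    then show "p = p'"
      by (simp add: p)
  qed
  have deg: "deg H (\<lambda>_. 1) v = card {p \<in> A \<times> B \<times> C. v \<in> tr p}" for v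
  proof -
    have "{e. e \<in> H \<and> v \<in> e} = tr ` {p \<in> A \<times> B \<times> C. v \<in> tr p}"
      unfolding H_def by auto
    moreover have "inj_on tr {p \<in> A \<times> B \<times> C. v \<in> tr p}"
      using inj by (rule inj_on_subset) auto
    ultimately show ?thesis
      by (simp add: deg_def card_image)
  qed
  have "{p \<in> A \<times> B \<times> C. v \<in> tr p} = {v} \<times> B \<times> C" if "v \<in> A" for v
    using that disj by (auto simp: tr_def)
  then have dA: "deg H (\<lambda>_. 1) v = card (B \<times> C)" if "v \<in> A" for v
    using that deg by (simp add: card_cartesian_product)
  have "{p \<in> A \<times> B \<times> C. v \<in> tr p} = A \<times> {v} \<times> C" if "v \<in> B" for v
    using that disj by (auto simp: tr_def)
  then have dB: "deg H (\<lambda>_. 1) v = card (A \<times> C)" if "v \<in> B" for v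
    using that deg by (simp add: card_cartesian_product)
  have "{p \<in> A \<times> B \<times> C. v \<in> tr p} = A \<times> B \<times> {v}" if "v \<in> C" for v
    using that disj by (auto simp: tr_def)
  then have dC: "deg H (\<lambda>_. 1) v = card (A \<times> B)" if "v \<in> C" for v
    using that deg by (simp add: card_cartesian_product)
  have all3: "(\<forall>t<length [A, B, C]. P t) \<longleftrightarrow> P 0 \<and> P 1 \<and> P 2" for P
    by (auto simp: less_Suc_eq numeral_2_eq_2)
  have "partite [A, B, C] H"
    unfolding partite_def all3
  proof (intro conjI ballI)
    show "finite H"
      using fin by (simp add: H_def)
    fix e assume "e \<in> H"
    then obtain a b c where e: "a \<in> A" "b \<in> B" "c \<in> C" "e = tr (a, b, c)"
      by (auto simp: H_def)
    then show "e \<subseteq> \<Union> (set [A, B, C])"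
      by (auto simp: tr_def)
    show "card (e \<inter> [A, B, C] ! 0) = 1" "card (e \<inter> [A, B, C] ! 1) = 1" "card (e \<inter> [A, B, C] ! 2) = 1"
      using meet[OF e(1-3)] e(4) by simp_all
  qed (use disj in auto)
  moreover have "balanced [A, B, C] H (\<lambda>_. 1)"
    unfolding balanced_def all3 using dA dB dC by simp
  moreover have "H \<noteq> {}"
    using assms by (auto simp: H_def A_def B_def C_def)
  then have "\<exists>f. (\<forall>e\<in>H. f e \<ge> 0) \<and> (\<exists>e\<in>H. f e \<noteq> 0) \<and> balanced [A, B, C] H f"
    using \<open>balanced [A, B, C] H (\<lambda>_. 1)\<close> by (intro exI[of _ "\<lambda>_. 1"]) auto
  moreover have "\<forall>t<length [k, n, n]. finite ([A, B, C] ! t) \<and> card ([A, B, C] ! t) = [k, n, n] ! t"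
    by (auto simp: less_Suc_eq A_def B_def C_def)
  ultimately have "fractionally_balanced [k, n, n] [A, B, C] H"
    unfolding fractionally_balanced_def by simp
  then show ?thesis
    by blast
qed

theorem theorem4p8:
  fixes k n :: nat
  assumes "0 < k" and "k \<le> n"
  shows "bm [k, n, n] \<ge> min k (nat \<lceil>real n / 2\<rceil>) \<and>
    (\<forall>(Vs :: 'a set list) (H :: 'a set set).
       fractionally_balanced [k, n, n] Vs H \<longrightarrow>
       (\<exists>M. matching H M \<and> card M = min k (nat \<lceil>real n / 2\<rceil>)))"
proof (intro conjI allI impI)
  have n: "0 < n"
    using assms by simp
  \<comment> \<open>Without a single such hypergraph every \<open>m\<close> would qualify vacuously,
    and there would be no greatest one.\<close>
  obtain Vs0 :: "nat set list" and H0 where H0: "fractionally_balanced [k, n, n] Vs0 H0"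
    using fractionally_balanced_exists[OF assms(1) n] by blast
  then have "finite H0"
    by (simp add: fractionally_balanced_def partite_def)
  \<comment> \<open>A matching in \<open>H0\<close> is a subset of \<open>H0\<close>, so the
    qualifying values are bounded and each of them is at most the \<open>GREATEST\<close>.\<close>
  have "m \<le> card H0"
    if "\<forall>(Vs :: nat set list) H. fractionally_balanced [k, n, n] Vs H \<longrightarrow>
      (\<exists>M. matching H M \<and> card M = m)" for m
    using that H0 card_mono[OF \<open>finite H0\<close>] unfolding matching_def by blast
  then show "min k (nat \<lceil>real n / 2\<rceil>) \<le> bm [k, n, n]"
    unfolding bm_def using fractionally_balanced_matching[OF assms(1) n]
    by (intro Greatest_le_nat[where b = "card H0"]) blast+
  show "\<exists>M. matching H M \<and> card M = min k (nat \<lceil>real n / 2\<rceil>)"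
    if "fractionally_balanced [k, n, n] Vs H" for Vs :: "'a set list" and H
    using that by (rule fractionally_balanced_matching[OF assms(1) n])
qed

end
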